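(* Let $a,b,c,d\ge0$, not all zero, with $a+c=b+d$. Put $p=\frac{a}{a+c}$, $r=\frac{b}{b+d}$, $\Delta=1-(p+r)$, $D=r-p$, $P=(2p-1)(2r-1)$. The edge correlation function $C_8(i,t)$, $i\in\mathbb Z$, $t\in\mathbb N$, of the 8-vertex model on $\overline K_\infty$ with free boundary condition (i.e. of $\overline P^8_\infty$) is: - if $i+t$ is odd, $$C_8(i,t)=(-1)^{t+1}D\sum_{k=0}^{\frac{t-1-|i|}{2}}(-1)^k\binom{t-1-k}{k,\ \frac{t-1+i}{2}-k,\ \frac{t-1-i}{2}-k}\Delta^{t-1-2k}P^k;$$ - if $t$ is even and $i=0$, $$C_8(0,t)=\sum_{k=0}^{t/2}(-1)^k\binom{t-1-k}{\frac t2-k}\binom{t/2}{k}\Delta^{t-2k}P^k;$$ - if $i+t$ is even and $i<0$, $$C_8(i,t)=\left(\sum_{k=0}^{\frac{t+i}{2}-1}(-1)^{t+k}\binom{t-1-k}{\frac{t-i}{2}-k}\binom{\frac{t+i}{2}}{k}\Delta^{t-2k}P^k\right)+(-1)^{\frac{t-i}{2}}\binom{\frac{t-i}{2}-1}{\frac{t+i}{2}-1}\Delta^{-i}P^{\frac{t+i}{2}};$$ - if $i+t$ is even and $i>0$, $$C_8(i,t)=\left(\sum_{k=0}^{\frac{t-i}{2}-1}(-1)^{t+k}\binom{t-1-k}{\frac{t-i}{2}-k}\binom{\frac{t+i}{2}}{k}\Delta^{t-2k}P^k\right)+(-1)^{\frac{t+i}{2}}\binom{\frac{t+i}{2}}{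\frac{t-i}{2}}\Delta^{i}P^{\frac{t-i}{2}}.$$
   Context: $\mathbb N=\{0,1,2,\dots\}$. $\mathrm{PM}(1/2)$ is the law on $\{0,1\}^{\mathbb Z}$ of i.i.d. Bernoulli$(1/2)$ variables indexed by $\mathbb Z$. The law $\mathcal L(\mu;p,r)$, for $\mu$ a probability measure on $\{0,1\}^{\mathbb Z}$ and $p,r\in[0,1]$, is the law of the random field $(e(i,t))_{i\in\mathbb Z,t\in\mathbb N}\in\{0,1\}^{\mathbb Z\times\mathbb N}$ such that $(e(i,0))_{i\in\mathbb Z}\sim\mu$ and $(e(\cdot,t))_{t\ge0}$ is a Markov chain such that, given line $t$, independently for all $i\in\mathbb Z$ with $i+t$ even, the pair $(e(i,t+1),e(i+1,t+1))$ depends only on $(e(i,t),e(i+1,t))$, with, for $k\in\{0,1\}$: $(k,k)\mapsto(k,k)$ with probability $r$ and $(k,k)\mapsto(1-k,1-k)$ with probability $1-r$; $(k,1-k)\mapsto(1-k,k)$ with probability $p$ and $(k,1-k)\mapsto(k,1-k)$ with probability $1-p$. (Here $e(i,t)\in\{0,1\}$ encodes the up/down orientation of the edge $(i,t)$ of the rotated half-plane square lattice $\overline K_\infty$.) The 8-vertex model on $\overline K_\infty$ with free boundary condition and weights $a,b,c,d$, $a+c=b+d$, is $\overline P^8_\infty=\mathcal L\left(\mathrm{PM}(1/2);\frac{a}{a+c},\frac{b}{b+d}\right)$, and for $(e(i,t))\sim\overline P^8_\infty$, $$C_8(i,t)=\frac{\mathrm{Cov}(e(0,0),e(i,t))}{\sqrt{\mathrm{Var}(e(0,0))}\sqrt{\mathrm{Var}(e(i,t))}}.$$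 Conventions: $\binom{n}{n_1,n_2,n_3}=\frac{n!}{n_1!n_2!n_3!}$ for $n=n_1+n_2+n_3$; $\binom{n}{0}=1$ for every integer $n\ge-1$ and $\binom nk=0$ if $k<0$ (a term with a zero binomial coefficient is zero); empty sums (upper limit negative) are $0$; $x^0=1$ for all $x$ including $0$. *)

theory Defs
  imports "HOL-Probability.Probability"
begin

text \<open>
  The alphabet \<open>{0,1}\<close> is rendered by \<^typ>\<open>bool\<close> (\<open>1 - k\<close> is \<open>\<not> k\<close>); values are turned
  into reals by \<^const>\<open>of_bool\<close> when moments are taken.
\<close>

abbreviation line_space :: "(int \<Rightarrow> bool) measure" where
  "line_space \<equiv> Pi\<^sub>M UNIV (\<lambda>_. count_space UNIV)"

definition PM :: "real \<Rightarrow> (int \<Rightarrow> bool) measure" where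
  "PM q = Pi\<^sub>M UNIV (\<lambda>_. measure_pmf (bernoulli_pmf q))"

text \<open>Meant for \<open>p, r \<in> [0, 1]\<close>: outside, \<^const>\<open>bernoulli_pmf\<close> clips its parameter.\<close>

definition cell_pmf :: "real \<Rightarrow> real \<Rightarrow> bool \<Rightarrow> bool \<Rightarrow> (bool \<times> bool) pmf" where
  "cell_pmf p r k l =
     (if k = l
      then map_pmf (\<lambda>s. if s then (k, k) else (\<not> k, \<not> k)) (bernoulli_pmf r)
      else map_pmf (\<lambda>s. if s then (\<not> k, k) else (k, \<not> k)) (bernoulli_pmf p))"

text \<open>
  The law of line \<open>t + 1\<close> given line \<open>x\<close> at time \<open>t\<close>: the pairs at positions \<open>(i, i + 1)\<close>, for
  \<open>i + t\<close> even, are drawn independently and then laid side by side.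
\<close>

definition line_kernel :: "real \<Rightarrow> real \<Rightarrow> nat \<Rightarrow> (int \<Rightarrow> bool) \<Rightarrow> (int \<Rightarrow> bool) measure" where
  "line_kernel p r t x =
     distr (Pi\<^sub>M {i. even (i + int t)} (\<lambda>i. measure_pmf (cell_pmf p r (x i) (x (i + 1)))))
       line_space
       (\<lambda>y j. if even (j + int t) then fst (y j) else snd (y (j - 1)))"

text \<open>
  The conditional law of line \<open>n\<close> given the lines \<open>0, \<dots>, n - 1\<close>, in the form expected by the
  Ionescu-Tulcea construction of the library.
\<close>

definition history_kernel ::
    "(int \<Rightarrow> bool) measure \<Rightarrow> real \<Rightarrow> real \<Rightarrow> nat \<Rightarrow> (nat \<Rightarrow> int \<Rightarrow> bool) \<Rightarrow> (int \<Rightarrow> bool) measure" where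
  "history_kernel \<mu> p r n h = (case n of 0 \<Rightarrow> \<mu> | Suc t \<Rightarrow> line_kernel p r t (h t))"

definition lines_law ::
    "(int \<Rightarrow> bool) measure \<Rightarrow> real \<Rightarrow> real \<Rightarrow> (nat \<Rightarrow> int \<Rightarrow> bool) measure" where
  "lines_law \<mu> p r =
     projective_family.lim UNIV (Ionescu_Tulcea.CI (history_kernel \<mu> p r) (\<lambda>_. line_space))
       (\<lambda>_. line_space)"

definition field_law ::
    "(int \<Rightarrow> bool) measure \<Rightarrow> real \<Rightarrow> real \<Rightarrow> (int \<times> nat \<Rightarrow> bool) measure" where
  "field_law \<mu> p r =
     distr (lines_law \<mu> p r) (Pi\<^sub>M UNIV (\<lambda>_. count_space UNIV)) (\<lambda>\<omega> (i, t). \<omega> t i)"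

text \<open>
  The constants \<^const>\<open>Ionescu_Tulcea.CI\<close> and \<^const>\<open>projective_family.lim\<close> are meaningful only
  under the assumptions of their locale. These hold here.
\<close>

lemma prob_space_PM: "prob_space (PM q)"
  unfolding PM_def by (intro prob_space_PiM prob_space_measure_pmf)

lemma sets_PM: "sets (PM q) = sets line_space"
  unfolding PM_def by (intro sets_PiM_cong) simp_all

lemma measurable_cells_to_line:
  "(\<lambda>y j. if even (j + int t) then fst (y j) else snd (y (j - 1)))
     \<in> Pi\<^sub>M {i. even (i + int t)} (\<lambda>_. count_space UNIV) \<rightarrow>\<^sub>M line_space"
proof (rule measurable_PiM_single')
  fix j :: int
  show "(\<lambda>y. if even (j + int t) then fst (y j) else snd (y (j - 1)))
      \<in> Pi\<^sub>M {i. even (i + int t)} (\<lambda>_. count_space UNIV) \<rightarrow>\<^sub>M (count_space UNIV :: bool measure)"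
  proof (cases "even (j + int t)")
    case True
    then have "(\<lambda>y. y j) \<in> Pi\<^sub>M {i. even (i + int t)} (\<lambda>_. count_space UNIV)
        \<rightarrow>\<^sub>M (count_space UNIV :: (bool \<times> bool) measure)"
      by (intro measurable_component_singleton) simp
    from measurable_compose[OF this, of fst "count_space UNIV"] True
    show ?thesis by simp
  next
    case False
    then have "(\<lambda>y. y (j - 1)) \<in> Pi\<^sub>M {i. even (i + int t)} (\<lambda>_. count_space UNIV)
        \<rightarrow>\<^sub>M (count_space UNIV :: (bool \<times> bool) measure)"
      by (intro measurable_component_singleton) simp
    from measurable_compose[OF this, of snd "count_space UNIV"] False
    show ?thesis by simp
  qed
qed simp

lemma measurable_cells:
  "(\<lambda>x. Pi\<^sub>M I (\<lambda>i. measure_pmf (cell_pmf p r (x i) (x (i + 1)))))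
     \<in> line_space \<rightarrow>\<^sub>M prob_algebra (Pi\<^sub>M I (\<lambda>_. count_space UNIV))"
proof (rule measurable_prob_algebra_generated
    [OF sets_PiM Int_stable_prod_algebra prod_algebra_sets_into_space])
  fix x :: "int \<Rightarrow> bool"
  show "prob_space (Pi\<^sub>M I (\<lambda>i. measure_pmf (cell_pmf p r (x i) (x (i + 1)))))"
    by (intro prob_space_PiM prob_space_measure_pmf)
  show "sets (Pi\<^sub>M I (\<lambda>i. measure_pmf (cell_pmf p r (x i) (x (i + 1)))))
      = sets (Pi\<^sub>M I (\<lambda>_. count_space UNIV))"
    by (intro sets_PiM_cong) simp_all
next
  fix A :: "(int \<Rightarrow> bool \<times> bool) set"
  assume "A \<in> prod_algebra I (\<lambda>_. count_space UNIV)"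
  then obtain J E where A: "A = prod_emb I (\<lambda>_. count_space UNIV) J (Pi\<^sub>E J E)"
    and J: "finite J" "J \<subseteq> I"
    by (rule prod_algebraE)
  have "emeasure (Pi\<^sub>M I (\<lambda>i. measure_pmf (cell_pmf p r (x i) (x (i + 1))))) A
      = (\<Prod>j\<in>J. emeasure (measure_pmf (cell_pmf p r (x j) (x (j + 1)))) (E j))" for x :: "int \<Rightarrow> bool"
  proof -
    interpret product_prob_space "\<lambda>i. measure_pmf (cell_pmf p r (x i) (x (i + 1)))" I
      by unfold_locales
    have "A = prod_emb I (\<lambda>i. measure_pmf (cell_pmf p r (x i) (x (i + 1)))) J (Pi\<^sub>E J E)"
      by (simp add: A prod_emb_def)
    then show ?thesis
      using J by (simp add: emeasure_PiM_emb)
  qed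
  moreover have "(\<lambda>x. emeasure (measure_pmf (cell_pmf p r (x j) (x (j + 1)))) (E j))
      \<in> borel_measurable line_space" for j :: int
  proof -
    have "(\<lambda>x. (x j, x (j + 1))) \<in> line_space \<rightarrow>\<^sub>M (count_space UNIV \<Otimes>\<^sub>M count_space UNIV)"
      by measurable
    then have "(\<lambda>x. (x j, x (j + 1))) \<in> line_space \<rightarrow>\<^sub>M (count_space UNIV :: (bool \<times> bool) measure)"
      by (simp add: pair_measure_countable)
    from measurable_compose[OF this,
        of "\<lambda>(k, l). emeasure (measure_pmf (cell_pmf p r k l)) (E j)" borel]
    show ?thesis by simp
  qed
  ultimately show "(\<lambda>x. emeasure (Pi\<^sub>M I (\<lambda>i. measure_pmf (cell_pmf p r (x i) (x (i + 1))))) A)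
      \<in> borel_measurable line_space"
    by simp
qed

lemma line_kernel_eq:
  "line_kernel p r t =
     (\<lambda>M. distr M line_space (\<lambda>y j. if even (j + int t) then fst (y j) else snd (y (j - 1))))
     \<circ> (\<lambda>x. Pi\<^sub>M {i. even (i + int t)} (\<lambda>i. measure_pmf (cell_pmf p r (x i) (x (i + 1)))))"
  by (simp add: fun_eq_iff line_kernel_def)

lemma measurable_line_kernel: "line_kernel p r t \<in> line_space \<rightarrow>\<^sub>M prob_algebra line_space"
  unfolding line_kernel_eq
  by (rule measurable_comp[OF measurable_cells
        measurable_distr_prob_space[OF measurable_cells_to_line]])

lemma prob_space_line_kernel: "prob_space (line_kernel p r t x)"
  using measurable_space[OF measurable_line_kernel, of x]
  by (simp add: space_PiM space_prob_algebra)

lemma Ionescu_Tulcea_history_kernel: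
  assumes "prob_space \<mu>" and "sets \<mu> = sets line_space"
  shows "Ionescu_Tulcea (history_kernel \<mu> p r) (\<lambda>_. line_space)"
proof (rule Ionescu_Tulcea.intro)
  fix n :: nat
  show "history_kernel \<mu> p r n \<in> Pi\<^sub>M {0..<n} (\<lambda>_. line_space) \<rightarrow>\<^sub>M subprob_algebra line_space"
  proof (cases n)
    case 0
    have "\<mu> \<in> space (subprob_algebra line_space)"
      using assms by (simp add: space_subprob_algebra prob_space_imp_subprob_space)
    moreover have "history_kernel \<mu> p r n = (\<lambda>_. \<mu>)"
      by (simp add: 0 history_kernel_def fun_eq_iff)
    ultimately show ?thesis
      by simp
  next
    case (Suc t)
    have "(\<lambda>h. h t) \<in> Pi\<^sub>M {0..<n} (\<lambda>_. line_space) \<rightarrow>\<^sub>M line_space"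
      using Suc by (intro measurable_component_singleton) simp
    then have "(\<lambda>h. line_kernel p r t (h t))
        \<in> Pi\<^sub>M {0..<n} (\<lambda>_. line_space) \<rightarrow>\<^sub>M subprob_algebra line_space"
      by (rule measurable_compose) (rule measurable_prob_algebraD[OF measurable_line_kernel])
    moreover have "history_kernel \<mu> p r n = (\<lambda>h. line_kernel p r t (h t))"
      by (simp add: Suc history_kernel_def fun_eq_iff)
    ultimately show ?thesis
      by simp
  qed
next
  fix n :: nat and h :: "nat \<Rightarrow> int \<Rightarrow> bool"
  show "prob_space (history_kernel \<mu> p r n h)"
    using assms(1) prob_space_line_kernel by (simp add: history_kernel_def split: nat.split)
qed

definition covariance :: "'a measure \<Rightarrow> ('a \<Rightarrow> real) \<Rightarrow> ('a \<Rightarrow> real) \<Rightarrow> real" where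
  "covariance M X Y =
     prob_space.expectation M
       (\<lambda>\<omega>. (X \<omega> - prob_space.expectation M X) * (Y \<omega> - prob_space.expectation M Y))"

definition P8 :: "real \<Rightarrow> real \<Rightarrow> real \<Rightarrow> real \<Rightarrow> (int \<times> nat \<Rightarrow> bool) measure" where
  "P8 a b c d = field_law (PM (1/2)) (a / (a + c)) (b / (b + d))"

definition C8 :: "real \<Rightarrow> real \<Rightarrow> real \<Rightarrow> real \<Rightarrow> int \<Rightarrow> nat \<Rightarrow> real" where
  "C8 a b c d i t =
     (let M = P8 a b c d; e = (\<lambda>z \<omega>. of_bool (\<omega> z))
      in covariance M (e (0, 0)) (e (i, t))
         / (sqrt (prob_space.variance M (e (0, 0))) * sqrt (prob_space.variance M (e (i, t)))))"

text \<open>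
  Conventions: \<open>n\<close> over \<open>0\<close> is \<open>1\<close> even for \<open>n = -1\<close>, and \<open>n\<close> over \<open>k\<close> is \<open>0\<close> for \<open>k < 0\<close>.
\<close>

definition binom :: "int \<Rightarrow> int \<Rightarrow> real" where
  "binom n k = (if k < 0 then 0 else if k = 0 then 1 else of_nat (nat n choose nat k))"

text \<open>Only used for nonnegative arguments with \<open>n = n\<^sub>1 + n\<^sub>2 + n\<^sub>3\<close>.\<close>

definition trinom :: "int \<Rightarrow> int \<Rightarrow> int \<Rightarrow> int \<Rightarrow> real" where
  "trinom n n\<^sub>1 n\<^sub>2 n\<^sub>3 = fact (nat n) / (fact (nat n\<^sub>1) * fact (nat n\<^sub>2) * fact (nat n\<^sub>3))"

end

theory Submission
  imports Defs
begin

text \<open>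
  With spins \<open>2 e - 1\<close> in place of \<open>e\<close>, the mean of each outgoing spin of a cell is a linear function
  of the two incoming spins, with coefficients \<open>D\<close> (same position) and \<open>-\<Delta>\<close> (other position).
  Hence the correlation with the spin at \<open>(0, 0)\<close> obeys a linear recursion in time whose initial
  value is a Kronecker delta. On odd sites its solution is, up to the sign and the factor \<open>D\<close>, the
  array \<open>T\<close> with generating function \<open>1 / (1 - \<Delta> x - \<Delta> y + P x y)\<close> in the light-cone coordinates
  \<open>m = (t - 1 + i) / 2\<close>, \<open>n = (t - 1 - i) / 2\<close>, because \<open>D\<^sup>2 = \<Delta>\<^sup>2 - P\<close>. On even sites it is
  \<open>T m n - \<Delta> T m (n - 1)\<close>, where \<open>m = (t + i) / 2\<close> and \<open>n = (t - i) / 2\<close>. Expanding \<open>T\<close> gives the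
  trinomial formula, and Pascal's rule turns the difference into the other two.
\<close>

subsection \<open>Spin moments of the line process\<close>

definition spin :: "bool \<Rightarrow> real" where
  "spin k = 2 * of_bool k - 1"

lemma abs_spin [simp]: "\<bar>spin k\<bar> = 1"
  by (simp add: spin_def)

lemma spin_square [simp]: "spin k * spin k = 1"
  by (simp add: spin_def)

lemma measurable_spin [measurable]: "spin \<in> borel_measurable (count_space UNIV)"
  by simp

text \<open>Equal inputs \<open>k\<close> give outputs of mean \<open>(2 * r - 1) * spin k\<close>;
  opposite inputs give a first output of mean \<open>(1 - 2 * p) * spin k\<close>. These two values
  are the sum and the difference of the stated coefficients, so one linear formula covers both
  rules.\<close>

lemma expectation_spin_cell_pmf:
  assumes "p \<in> {0..1}" and "r \<in> {0..1}"
  shows "measure_pmf.expectation (cell_pmf p r k l) (\<lambda>z. spin (fst z))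
           = (r - p) * spin k - (1 - (p + r)) * spin l"
    and "measure_pmf.expectation (cell_pmf p r k l) (\<lambda>z. spin (snd z))
           = (r - p) * spin l - (1 - (p + r)) * spin k"
  using assms
  by (cases k; cases l; simp add: cell_pmf_def spin_def algebra_simps)+

text \<open>Position \<open>j\<close> lies in exactly one cell, whose left end is \<open>j\<close>
  or \<open>j - 1\<close> by parity. Only the marginal of that cell enters, and the second neighbour
  is its other end.\<close>

lemma integral_line_kernel_spin:
  assumes "p \<in> {0..1}" and "r \<in> {0..1}"
  shows "(\<integral>x. spin (x j) \<partial>line_kernel p r t y)
           = (r - p) * spin (y j) - (1 - (p + r)) * spin (y (if even (j + int t) then j + 1 else j - 1))"
proof -
  let ?M = "\<lambda>i. measure_pmf (cell_pmf p r (y i) (y (i + 1)))"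
  let ?I = "{i. even (i + int t)}"
  let ?side = "if even (j + int t) then fst else snd" and ?cell = "if even (j + int t) then j else j - 1"
  have cells: "(\<lambda>z j. if even (j + int t) then fst (z j) else snd (z (j - 1))) \<in> Pi\<^sub>M ?I ?M \<rightarrow>\<^sub>M line_space"
  proof -
    have "sets (Pi\<^sub>M ?I ?M) = sets (Pi\<^sub>M ?I (\<lambda>_. count_space UNIV))"
      by (rule sets_PiM_cong) simp_all
    then show ?thesis
      by (subst measurable_cong_sets[OF _ refl]) (assumption, rule measurable_cells_to_line)
  qed
  have spin: "(\<lambda>x. spin (x j)) \<in> borel_measurable line_space"
    by measurable
  have cell: "?cell \<in> ?I"
    by simp
  have "(\<integral>x. spin (x j) \<partial>line_kernel p r t y) = (\<integral>z. spin (?side (z ?cell)) \<partial>Pi\<^sub>M ?I ?M)"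
    unfolding line_kernel_def integral_distr[OF cells spin] by (simp cong: if_cong)
  also have "\<dots> = (\<integral>z. spin (?side z) \<partial>distr (Pi\<^sub>M ?I ?M) (?M ?cell) (\<lambda>z. z ?cell))"
    by (rule integral_distr[symmetric]) (rule measurable_component_singleton[OF cell], simp)
  also have "\<dots> = (\<integral>z. spin (?side z) \<partial>?M ?cell)"
    by (subst distr_PiM_component[OF prob_space_measure_pmf cell]) (rule refl)
  also have "\<dots> = (r - p) * spin (y j) - (1 - (p + r)) * spin (y (if even (j + int t) then j + 1 else j - 1))"
    using expectation_spin_cell_pmf[OF assms] by simp
  finally show ?thesis .
qed

section \<open>Marginals of the infinite line process and conditioning on the past\<close>

context
  fixes \<mu> :: "(int \<Rightarrow> bool) measure" and p r :: real
  assumes \<mu>: "prob_space \<mu>" "sets \<mu> = sets line_space"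
begin

interpretation IT: Ionescu_Tulcea "history_kernel \<mu> p r" "\<lambda>_. line_space"
  by (rule Ionescu_Tulcea_history_kernel[OF \<mu>])

text \<open>The joint law of the lines with index below \<open>n\<close>. The start
  \<open>\<lambda>_. undefined\<close> is the only point of a product over the empty index set, that
  is, the empty history.\<close>

abbreviation lines :: "nat \<Rightarrow> (nat \<Rightarrow> int \<Rightarrow> bool) measure" where
  "lines n \<equiv> IT.C 0 n (\<lambda>_. undefined)"

lemma sets_lines: "sets (lines n) = sets (Pi\<^sub>M {0..<n} (\<lambda>_. line_space))"
  by (simp add: IT.sets_C)

lemma sets_lines_law: "sets (lines_law \<mu> p r) = sets (Pi\<^sub>M UNIV (\<lambda>_. line_space))"
  unfolding lines_law_def by simp

lemma distr_lines_law:
  "distr (lines_law \<mu> p r) (Pi\<^sub>M {0..<n} (\<lambda>_. line_space)) (\<lambda>\<omega>. restrict \<omega> {0..<n}) = lines n"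
proof -
  \<comment> \<open>The library builds the marginal on an index set from the first
    \<open>up_to\<close> lines and then restricts. For an initial segment that number is exactly
    \<open>n\<close>, so the restriction changes nothing.\<close>
  have "IT.up_to {0..<n} \<le> n"
    by (subst IT.up_to_iff) auto
  moreover have "n \<le> IT.up_to {0..<n}"
    using IT.up_to[of "{0..<n}"] by (cases n) auto
  ultimately have "IT.up_to {0..<n} = n"
    by simp
  then show ?thesis
    unfolding lines_law_def using IT.distr_C[of n n "\<lambda>_. undefined" 0]
    by (simp add: IT.distr_lim IT.CI_def)
qed

lemma prob_space_lines: "prob_space (lines n)"
  by (rule IT.prob_space_C) simp

text \<open>A measurable map preserves total mass, so it suffices that the image under restriction
  to the empty history is a probability measure.\<close>

lemma prob_space_lines_law: "prob_space (lines_law \<mu> p r)"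
proof (rule prob_space_distrD)
  show "(\<lambda>\<omega>. restrict \<omega> {0..<0::nat})
      \<in> lines_law \<mu> p r \<rightarrow>\<^sub>M Pi\<^sub>M {0..<0::nat} (\<lambda>_. line_space)"
    unfolding measurable_cong_sets[OF sets_lines_law refl]
    by (rule measurable_restrict_subset) simp
  show "prob_space (distr (lines_law \<mu> p r) (Pi\<^sub>M {0..<0::nat} (\<lambda>_. line_space))
      (\<lambda>\<omega>. restrict \<omega> {0..<0::nat}))"
    unfolding distr_lines_law by (rule prob_space_lines)
qed

lemma integral_lines_law:
  fixes f :: "(nat \<Rightarrow> int \<Rightarrow> bool) \<Rightarrow> real"
  assumes "f \<in> borel_measurable (Pi\<^sub>M {0..<n} (\<lambda>_. line_space))"
  shows "(\<integral>\<omega>. f (restrict \<omega> {0..<n}) \<partial>lines_law \<mu> p r) = (\<integral>\<omega>. f \<omega> \<partial>lines n)"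
proof -
  have "(\<lambda>\<omega>. restrict \<omega> {0..<n}) \<in> lines_law \<mu> p r \<rightarrow>\<^sub>M Pi\<^sub>M {0..<n} (\<lambda>_. line_space)"
    unfolding measurable_cong_sets[OF sets_lines_law refl]
    by (rule measurable_restrict_subset) simp
  then show ?thesis
    using assms by (simp flip: distr_lines_law add: integral_distr)
qed

text \<open>The law of one more line is a bind with the kernel that appends it. Boundedness of
  \<open>f\<close> on probability spaces justifies iterating the Bochner integrals.\<close>

lemma integral_lines_Suc:
  fixes f :: "(nat \<Rightarrow> int \<Rightarrow> bool) \<Rightarrow> real"
  assumes f: "f \<in> borel_measurable (Pi\<^sub>M {0..<Suc n} (\<lambda>_. line_space))"
    and bound: "\<And>\<omega>. \<bar>f \<omega>\<bar> \<le> B"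
  shows "(\<integral>\<omega>. f \<omega> \<partial>lines (Suc n))
           = (\<integral>\<omega>. (\<integral>x. f (fun_upd \<omega> n x) \<partial>history_kernel \<mu> p r n \<omega>) \<partial>lines n)"
proof -
  interpret prob_space "lines n"
    by (rule prob_space_lines)
  have space: "space (lines n) = space (Pi\<^sub>M {0..<n} (\<lambda>_. line_space))"
    by (rule sets_eq_imp_space_eq[OF sets_lines])
  have "(\<integral>\<omega>. f \<omega> \<partial>lines (Suc n)) = (\<integral>\<omega>. (\<integral>\<omega>'. f \<omega>' \<partial>IT.eP n \<omega>) \<partial>lines n)"
  proof (simp, rule integral_bind[OF f])
    show "IT.eP n \<in> lines n \<rightarrow>\<^sub>M subprob_algebra (Pi\<^sub>M {0..<Suc n} (\<lambda>_. line_space))"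
      unfolding measurable_cong_sets[OF sets_lines refl] by (rule IT.measurable_eP)
    show "AE \<omega> in lines n. emeasure (IT.eP n \<omega>) (space (IT.eP n \<omega>)) \<le> ennreal 1"
    proof (rule AE_I2)
      fix \<omega> assume "\<omega> \<in> space (lines n)"
      then have "prob_space (IT.eP n \<omega>)"
        unfolding space by (rule IT.prob_space_eP)
      then show "emeasure (IT.eP n \<omega>) (space (IT.eP n \<omega>)) \<le> ennreal 1"
        by (simp add: prob_space.emeasure_space_1)
    qed
  qed (use bound in \<open>auto intro: finite_measure_axioms\<close>)
  also have "\<dots> = (\<integral>\<omega>. (\<integral>x. f (fun_upd \<omega> n x) \<partial>history_kernel \<mu> p r n \<omega>) \<partial>lines n)"
  proof (rule Bochner_Integration.integral_cong[OF refl])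
    fix \<omega> assume "\<omega> \<in> space (lines n)"
    then have \<omega>: "\<omega> \<in> space (Pi\<^sub>M {0..<n} (\<lambda>_. line_space))"
      by (simp add: space)
    then have "fun_upd \<omega> n \<in> history_kernel \<mu> p r n \<omega> \<rightarrow>\<^sub>M Pi\<^sub>M {0..<Suc n} (\<lambda>_. line_space)"
      unfolding measurable_cong_sets[OF IT.sets_P[OF \<omega>] refl]
      by (intro measurable_fun_upd[where J="{0..<n}"]) auto
    then show "(\<integral>\<omega>'. f \<omega>' \<partial>IT.eP n \<omega>) = (\<integral>x. f (fun_upd \<omega> n x) \<partial>history_kernel \<mu> p r n \<omega>)"
      unfolding IT.eP_def using f by (rule integral_distr)
  qed
  finally show ?thesis .
qed

lemma integral_lines_law_initial:
  fixes g :: "(int \<Rightarrow> bool) \<Rightarrow> real"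
  assumes g [measurable]: "g \<in> borel_measurable line_space" and bound: "\<And>x. \<bar>g x\<bar> \<le> B"
  shows "(\<integral>\<omega>. g (\<omega> 0) \<partial>lines_law \<mu> p r) = (\<integral>x. g x \<partial>\<mu>)"
proof -
  have m: "(\<lambda>\<omega>. g (\<omega> 0)) \<in> borel_measurable (Pi\<^sub>M {0..<Suc 0} (\<lambda>_. line_space))"
    by measurable
  have "(\<integral>\<omega>. g (\<omega> 0) \<partial>lines_law \<mu> p r) = (\<integral>\<omega>. g (\<omega> 0) \<partial>lines (Suc 0))"
    by (subst integral_lines_law[OF m, symmetric]) simp
  also have "\<dots> = (\<integral>\<omega>. (\<integral>x. g x \<partial>\<mu>) \<partial>lines 0)"
    by (subst integral_lines_Suc[OF m bound]) (simp add: history_kernel_def del: IT.C.simps)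
  also have "\<dots> = (\<integral>x. g x \<partial>\<mu>)"
    using prob_space.prob_space[OF prob_space_lines[of 0]] by (simp del: IT.C.simps)
  finally show ?thesis .
qed

text \<open>Condition on lines \<open>0\<close> to \<open>t\<close> and apply the cell means. The
  factor \<open>g\<close> of the initial line lets the same recursion serve for means
  (\<open>g\<close> constant) and for correlations (\<open>g\<close> the spin at the
  origin).\<close>

lemma integral_lines_law_spin_Suc:
  fixes g :: "(int \<Rightarrow> bool) \<Rightarrow> real"
  assumes g [measurable]: "g \<in> borel_measurable line_space" and bound: "\<And>x. \<bar>g x\<bar> \<le> 1"
    and "p \<in> {0..1}" and "r \<in> {0..1}"
  shows "(\<integral>\<omega>. g (\<omega> 0) * spin (\<omega> (Suc t) j) \<partial>lines_law \<mu> p r)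
           = (r - p) * (\<integral>\<omega>. g (\<omega> 0) * spin (\<omega> t j) \<partial>lines_law \<mu> p r)
             - (1 - (p + r)) * (\<integral>\<omega>. g (\<omega> 0)
                 * spin (\<omega> t (if even (j + int t) then j + 1 else j - 1)) \<partial>lines_law \<mu> p r)"
proof -
  let ?j = "if even (j + int t) then j + 1 else j - 1"
  have m: "(\<lambda>\<omega>. g (\<omega> 0) * spin (\<omega> s i)) \<in> borel_measurable (Pi\<^sub>M {0..<n} (\<lambda>_. line_space))"
    if that': "s < n" for s n :: nat and i
  proof -
    have [measurable]: "(\<lambda>\<omega>. \<omega> u) \<in> Pi\<^sub>M {0..<n} (\<lambda>_. line_space) \<rightarrow>\<^sub>M line_space" if "u \<le> s" for u
      using that that' by (intro measurable_component_singleton) auto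
    have [measurable]: "(\<lambda>x. x i) \<in> line_space \<rightarrow>\<^sub>M count_space UNIV"
      by (intro measurable_component_singleton) auto
    show ?thesis
      by measurable
  qed
  have b: "\<bar>g (\<omega> 0) * spin (\<omega> s i)\<bar> \<le> 1" for \<omega> s i
    using bound by (simp add: abs_mult)
  have law: "(\<integral>\<omega>. g (\<omega> 0) * spin (\<omega> s i) \<partial>lines_law \<mu> p r) = (\<integral>\<omega>. g (\<omega> 0) * spin (\<omega> s i) \<partial>lines n)"
    if "s < n" for s i n
    using that by (subst integral_lines_law[OF m[OF that], symmetric]) auto
  interpret prob_space "lines (Suc t)"
    by (rule prob_space_lines)
  have int: "integrable (lines (Suc t)) (\<lambda>\<omega>. g (\<omega> 0) * spin (\<omega> t i))" for i
    using m[of t "Suc t" i] b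
    by (intro integrable_const_bound[where B=1]) (auto simp: measurable_cong_sets[OF sets_lines refl] simp del: IT.C.simps)
  have "(\<integral>\<omega>. g (\<omega> 0) * spin (\<omega> (Suc t) j) \<partial>lines_law \<mu> p r)
      = (\<integral>\<omega>. g (\<omega> 0) * spin (\<omega> (Suc t) j) \<partial>lines (Suc (Suc t)))"
    by (rule law) simp
  \<comment> \<open>Appending line \<open>Suc t\<close> leaves line \<open>0\<close> untouched, so
    \<open>g (\<omega> 0)\<close> is constant in the inner integral.\<close>
  also have "\<dots> = (\<integral>\<omega>. (\<integral>x. g (\<omega> 0) * spin (x j) \<partial>line_kernel p r t (\<omega> t)) \<partial>lines (Suc t))"
    using b by (subst integral_lines_Suc[OF m[of "Suc t" _ j, OF lessI], where B = 1])
       (simp_all add: history_kernel_def del: IT.C.simps abs_mult)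
  also have "\<dots> = (\<integral>\<omega>. (r - p) * (g (\<omega> 0) * spin (\<omega> t j))
      - (1 - (p + r)) * (g (\<omega> 0) * spin (\<omega> t ?j)) \<partial>lines (Suc t))"
    by (simp only: integral_mult_right_zero integral_line_kernel_spin[OF assms(3,4)])
       (simp add: algebra_simps del: IT.C.simps)
  also have "\<dots> = (r - p) * (\<integral>\<omega>. g (\<omega> 0) * spin (\<omega> t j) \<partial>lines (Suc t))
      - (1 - (p + r)) * (\<integral>\<omega>. g (\<omega> 0) * spin (\<omega> t ?j) \<partial>lines (Suc t))"
    using int by (simp only: Bochner_Integration.integral_diff integrable_mult_right integral_mult_right_zero)
  finally show ?thesis
    by (simp only: law[of t "Suc t"] lessI)
qed

end

section \<open>First and second moments of the initial line\<close>

lemma integral_PM_half_spin_mult: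
  "(\<integral>x. spin (x i) * spin (x j) \<partial>PM (1/2)) = of_bool (i = j)"
proof (cases "i = j")
  case True
  then show ?thesis
    using prob_space.prob_space[OF prob_space_PM] by simp
next
  case False
  let ?M = "\<lambda>_::int. measure_pmf (bernoulli_pmf (1/2))"
  interpret product_prob_space ?M "UNIV :: int set"
    by unfold_locales
  have m: "(\<lambda>x. \<Prod>k\<in>{i,j}. spin (x k)) \<in> borel_measurable (Pi\<^sub>M {i,j} ?M)"
    by measurable
  \<comment> \<open>Passing to the finite product over \<open>{i,j}\<close> makes the integral
    factor into two means, each zero.\<close>
  have "(\<integral>x. spin (x i) * spin (x j) \<partial>PM (1/2))
      = (\<integral>x. (\<Prod>k\<in>{i,j}. spin (restrict x {i,j} k)) \<partial>Pi\<^sub>M UNIV ?M)"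
    using False by (simp add: PM_def)
  also have "\<dots> = (\<integral>x. (\<Prod>k\<in>{i,j}. spin (x k)) \<partial>Pi\<^sub>M {i,j} ?M)"
    using m by (subst distr_PiM_restrict_finite[of "{i,j}", symmetric])
       (auto simp: integral_distr measurable_restrict_subset)
  also have "\<dots> = (\<Prod>k\<in>{i,j}. measure_pmf.expectation (bernoulli_pmf (1/2)) spin)"
    by (rule product_integral_prod) (auto intro: integrable_measure_pmf_finite)
  also have "\<dots> = 0"
    using False by (simp add: spin_def)
  finally show ?thesis
    using False by simp
qed

lemma integral_PM_half_spin: "(\<integral>x. spin (x i) \<partial>PM (1/2)) = 0"
proof -
  let ?M = "\<lambda>_::int. measure_pmf (bernoulli_pmf (1/2))"
  have "(\<integral>x. spin (x i) \<partial>PM (1/2)) = (\<integral>k. spin k \<partial>distr (Pi\<^sub>M UNIV ?M) (?M i) (\<lambda>x. x i))"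
    unfolding PM_def by (subst integral_distr) (auto intro: measurable_component_singleton)
  also have "\<dots> = 0"
    by (subst distr_PiM_component) (auto intro: prob_space_measure_pmf simp: spin_def)
  finally show ?thesis .
qed

subsection \<open>The linear recursion and its solution\<close>

text \<open>
  The multinomial coefficient of \<open>k, m - k, n - k\<close>, in a form that vanishes for \<open>k > min m n\<close> in
  spite of truncated subtraction.
\<close>

definition path_weight :: "nat \<Rightarrow> nat \<Rightarrow> nat \<Rightarrow> nat" where
  "path_weight m n k = (m + n - k choose m) * (m choose k)"

lemma path_weight_eq_0: "k > m \<or> k > n \<Longrightarrow> path_weight m n k = 0"
  by (cases "m = 0") (auto simp: path_weight_def binomial_eq_0)

lemma path_weight_multinomial:
  assumes "k \<le> m" and "k \<le> n"
  shows "real (path_weight m n k) = fact (m + n - k) / (fact k * fact (m - k) * fact (n - k))"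
proof -
  have "real (m + n - k choose m) = fact (m + n - k) / (fact m * fact (n - k))"
    using assms binomial_fact[of m "m + n - k", where 'a=real] by simp
  moreover have "real (m choose k) = fact m / (fact k * fact (m - k))"
    using assms by (simp add: binomial_fact)
  ultimately show ?thesis
    by (simp add: path_weight_def)
qed

lemma path_weight_Suc_0: "path_weight (Suc m) (Suc n) 0 = path_weight m (Suc n) 0 + path_weight (Suc m) n 0"
  by (simp add: path_weight_def)

text \<open>The weight counts lattice paths from the origin to \<open>(m, n)\<close> with unit steps
  along the axes and exactly \<open>k\<close> diagonal steps. The three summands sort the paths by
  their last step.\<close>

lemma path_weight_Suc_Suc:
  "path_weight (Suc m) (Suc n) (Suc k)
     = path_weight m (Suc n) (Suc k) + path_weight (Suc m) n (Suc k) + path_weight m n k"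
proof (cases "k \<le> m \<and> k \<le> n")
  case True
  \<comment> \<open>Writing \<open>n = k + l\<close> removes the truncated subtraction and leaves
    Pascal's rule; for \<open>l = 0\<close> the middle summand vanishes.\<close>
  then obtain l where l: "n = k + l" by (auto simp: le_iff_add)
  show ?thesis
    unfolding path_weight_def l
    by (cases l) (auto simp: algebra_simps binomial_eq_0)
next
  case False
  then show ?thesis
    by (auto simp: path_weight_eq_0)
qed

text \<open>The array T of the introduction, as a weighted path count: each unit step contributes
  \<Delta> and each diagonal step -P. Summands with \<open>k > n\<close> vanish, so the bound
  \<open>m\<close> is enough.\<close>

definition path_sum :: "real \<Rightarrow> real \<Rightarrow> nat \<Rightarrow> nat \<Rightarrow> real" where
  "path_sum \<Delta> P m n = (\<Sum>k\<le>m. (- P) ^ k * path_weight m n k * \<Delta> ^ (m + n - 2 * k))"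

lemma path_sum_extend:
  assumes "min m n \<le> K"
  shows "path_sum \<Delta> P m n = (\<Sum>k\<le>K. (- P) ^ k * path_weight m n k * \<Delta> ^ (m + n - 2 * k))"
proof -
  have "(\<Sum>k\<le>L. (- P) ^ k * path_weight m n k * \<Delta> ^ (m + n - 2 * k))
      = (\<Sum>k\<le>min m n. (- P) ^ k * path_weight m n k * \<Delta> ^ (m + n - 2 * k))" if "min m n \<le> L" for L
    by (rule sum.mono_neutral_right) (use that in \<open>auto simp: path_weight_eq_0\<close>)
  from this[of m] this[of K] assms show ?thesis
    by (simp add: path_sum_def)
qed

lemma path_sum_0_left: "path_sum \<Delta> P 0 n = \<Delta> ^ n"
  by (simp add: path_sum_def path_weight_def)

lemma path_sum_0_right: "path_sum \<Delta> P m 0 = \<Delta> ^ m"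
  by (subst path_sum_extend[of _ _ 0]) (simp_all add: path_weight_def)

text \<open>The weighted form of sorting paths by their last step; equivalently, a coefficient of
  the identity (1 - \<Delta> x - \<Delta> y + P x y) T = 1.\<close>

lemma path_sum_Suc_Suc:
  "path_sum \<Delta> P (Suc m) (Suc n)
     = \<Delta> * path_sum \<Delta> P m (Suc n) + \<Delta> * path_sum \<Delta> P (Suc m) n - P * path_sum \<Delta> P m n"
proof -
  let ?s = "\<lambda>m n k. (- P) ^ k * path_weight m n k * \<Delta> ^ (m + n - 2 * k)"
  \<comment> \<open>Truncated exponents could spoil this rule only where the weight is zero.\<close>
  have power: "\<Delta> * ?s m' n' k = (- P) ^ k * path_weight m' n' k * \<Delta> ^ (Suc (m' + n') - 2 * k)" for m' n' k
  proof (cases "k \<le> m' \<and> k \<le> n'")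
    case True
    then have "Suc (m' + n') - 2 * k = Suc (m' + n' - 2 * k)"
      by linarith
    then show ?thesis
      by simp
  next
    case False
    then show ?thesis
      by (auto simp: path_weight_eq_0)
  qed
  \<comment> \<open>The summand \<open>k = 0\<close> has no diagonal predecessor and is split off;
    the others are shifted by one.\<close>
  have "path_sum \<Delta> P (Suc m) (Suc n) = ?s (Suc m) (Suc n) 0 + (\<Sum>k\<le>m. ?s (Suc m) (Suc n) (Suc k))"
    unfolding path_sum_def sum.atMost_Suc_shift ..
  also have "?s (Suc m) (Suc n) 0 = \<Delta> * ?s m (Suc n) 0 + \<Delta> * ?s (Suc m) n 0"
    by (simp add: path_weight_Suc_0 algebra_simps)
  also have "(\<Sum>k\<le>m. ?s (Suc m) (Suc n) (Suc k))
      = (\<Sum>k\<le>m. \<Delta> * ?s m (Suc n) (Suc k)) + (\<Sum>k\<le>m. \<Delta> * ?s (Suc m) n (Suc k)) - P * (\<Sum>k\<le>m. ?s m n k)"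
    unfolding power sum_distrib_left sum.distrib[symmetric] sum_subtractf[symmetric]
    by (rule sum.cong) (simp_all add: path_weight_Suc_Suc algebra_simps)
  also have "(\<Sum>k\<le>m. ?s m n k) = path_sum \<Delta> P m n"
    by (simp add: path_sum_def)
  finally have *: "path_sum \<Delta> P (Suc m) (Suc n)
      = (\<Delta> * ?s m (Suc n) 0 + (\<Sum>k\<le>m. \<Delta> * ?s m (Suc n) (Suc k)))
        + (\<Delta> * ?s (Suc m) n 0 + (\<Sum>k\<le>m. \<Delta> * ?s (Suc m) n (Suc k))) - P * path_sum \<Delta> P m n"
    by simp
  have "\<Delta> * ?s m' n' 0 + (\<Sum>k\<le>m. \<Delta> * ?s m' n' (Suc k)) = \<Delta> * path_sum \<Delta> P m' n'"
    if "m' \<le> Suc m" for m' n'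
    using that
    by (subst path_sum_extend[of _ _ "Suc m"])
       (use that in \<open>auto simp del: sum.atMost_Suc simp add: sum.atMost_Suc_shift sum_distrib_left distrib_left\<close>)
  from this[of m "Suc n"] this[of "Suc m" n] * show ?thesis
    by linarith
qed

text \<open>Both terms share the factor \<open>m choose k\<close>. Pascal's rule reduces the
  difference of the other factors to \<open>m + n - k\<close> over \<open>m - 1\<close>, and
  symmetry turns the lower index into \<open>Suc n - k\<close>.\<close>

lemma path_sum_diff:
  "path_sum \<Delta> P m (Suc n) - \<Delta> * path_sum \<Delta> P m n
     = (\<Sum>k\<le>min m (Suc n). (- 1) ^ k * real ((m + n - k choose (Suc n - k)) * (m choose k))
           * \<Delta> ^ (m + Suc n - 2 * k) * P ^ k)" (is "_ = ?R")
  if "m > 0"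
proof -
  have "path_sum \<Delta> P m (Suc n) - \<Delta> * path_sum \<Delta> P m n
     = (\<Sum>k\<le>min m (Suc n). (- P) ^ k * path_weight m (Suc n) k * \<Delta> ^ (m + Suc n - 2 * k)
          - \<Delta> * ((- P) ^ k * path_weight m n k * \<Delta> ^ (m + n - 2 * k)))"
    using path_sum_extend[of m n "min m (Suc n)"] path_sum_extend[of m "Suc n" "min m (Suc n)"]
    by (simp add: sum_distrib_left sum_subtractf)
  also have "\<dots> = ?R"
  proof (rule sum.cong[OF refl])
    fix k assume k: "k \<in> {..min m (Suc n)}"
    show "(- P) ^ k * path_weight m (Suc n) k * \<Delta> ^ (m + Suc n - 2 * k)
        - \<Delta> * ((- P) ^ k * path_weight m n k * \<Delta> ^ (m + n - 2 * k))
        = (- 1) ^ k * real ((m + n - k choose (Suc n - k)) * (m choose k)) * \<Delta> ^ (m + Suc n - 2 * k) * P ^ k"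
    \<comment> \<open>At \<open>k = Suc n\<close> the subtracted weight is zero and the remaining
      binomial has lower index \<open>0\<close>; this case also falls outside the exponent rule used
      below.\<close>
    proof (cases "k = Suc n")
      case True
      with k have "m \<ge> Suc n" by simp
      then show ?thesis
        using True by (simp add: path_weight_eq_0 path_weight_def power_minus[of P])
    next
      case False
      with k have le: "k \<le> m" "k \<le> n" by auto
      obtain m' where m': "m = Suc m'"
        using \<open>m > 0\<close> gr0_conv_Suc by blast
      have "m + Suc n - k = Suc (m + n - k)" and pw: "m + Suc n - 2 * k = Suc (m + n - 2 * k)"
        using le by auto
      moreover have "m + n - k choose (Suc n - k) = (m + n - k choose m')"
        using le m' binomial_symmetric[of m' "m + n - k"] by (simp add: Suc_diff_le)
      ultimately have "path_weight m (Suc n) k = path_weight m n k + (m + n - k choose (Suc n - k)) * (m choose k)"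
        by (simp add: path_weight_def m' algebra_simps)
      then show ?thesis
        unfolding pw by (simp add: algebra_simps power_minus[of P])
    qed
  qed
  finally show ?thesis .
qed

section \<open>Extension to integer coordinates and the correlation recursion\<close>

definition half_path_sum :: "real \<Rightarrow> real \<Rightarrow> int \<Rightarrow> int \<Rightarrow> real" where
  "half_path_sum \<Delta> P m n = (if m < 0 \<or> n < 0 then 0 else path_sum \<Delta> P (nat m) (nat n))"

text \<open>Extension by zero makes one recursion valid on the axes too, where the values are powers
  of \<Delta>. It fails only at the origin, where the value is 1.\<close>

lemma half_path_sum_rec:
  assumes "\<not> (m = 0 \<and> n = 0)"
  shows "half_path_sum \<Delta> P m n = \<Delta> * half_path_sum \<Delta> P (m - 1) n
     + \<Delta> * half_path_sum \<Delta> P m (n - 1) - P * half_path_sum \<Delta> P (m - 1) (n - 1)"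
proof (cases "m < 0 \<or> n < 0")
  case True
  then show ?thesis by (auto simp: half_path_sum_def)
next
  case False
  then obtain m' n' where "m = int m'" "n = int n'"
    by (metis linorder_not_less nonneg_int_cases)
  with assms show ?thesis
    by (cases m'; cases n')
       (auto simp: half_path_sum_def path_sum_0_left path_sum_0_right path_sum_Suc_Suc nat_add_distrib)
qed

definition correlation :: "real \<Rightarrow> real \<Rightarrow> real \<Rightarrow> int \<Rightarrow> nat \<Rightarrow> real" where
  "correlation \<Delta> D P i t =
     (if odd (i + int t)
      then (- 1) ^ Suc t * D * half_path_sum \<Delta> P ((int t - 1 + i) div 2) ((int t - 1 - i) div 2)
      else (- 1) ^ t * (half_path_sum \<Delta> P ((int t + i) div 2) ((int t - i) div 2)
             - \<Delta> * half_path_sum \<Delta> P ((int t + i) div 2) ((int t - i) div 2 - 1)))"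

text \<open>At time 0 the two coordinates add up to 0 or -1, so one of them is negative unless
  \<open>i = 0\<close>.\<close>

lemma correlation_0: "correlation \<Delta> D P i 0 = of_bool (i = 0)"
proof (cases "i = 0")
  case False
  then have "i div 2 < 0 \<or> - i div 2 < 0" if "even i" using that by auto
  moreover have "(i - 1) div 2 < 0 \<or> (- 1 - i) div 2 < 0" if "odd i" by presburger
  ultimately show ?thesis
    using False by (auto simp: correlation_def half_path_sum_def)
qed (simp add: correlation_def half_path_sum_def path_sum_0_left)

lemma correlation_Suc:
  assumes "D\<^sup>2 = \<Delta>\<^sup>2 - P"
  shows "correlation \<Delta> D P i (Suc t) = D * correlation \<Delta> D P i t
           - \<Delta> * correlation \<Delta> D P (if even (i + int t) then i + 1 else i - 1) t"
proof (cases "even (i + int t)")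
  case True
  \<comment> \<open>The neighbour \<open>i + 1\<close> contributes the value at
    \<open>(m, n - 1)\<close>, which cancels the second term of the even-site formula at
    \<open>i\<close>.\<close>
  have "(int t - 1 - (i + 1)) div 2 = (int t - i) div 2 - 1"
    by presburger
  with True show ?thesis
    by (simp add: correlation_def ring_distribs add_ac)
next
  case False
  define m n where "m = (int t + 1 + i) div 2" and "n = (int t + 1 - i) div 2"
  have *: "(1 + int t + i) div 2 = m" "(1 + int t - i) div 2 = n" "(int t - 1 + i) div 2 = m - 1"
     "(int t - 1 - i) div 2 = n - 1" "(int t + (i - 1)) div 2 = m - 1" "(int t - (i - 1)) div 2 = n"
    unfolding m_def n_def by (simp_all add: algebra_simps)
  have "m + n = int t + 1"
    using False unfolding m_def n_def by presburger
  then have "\<not> (m = 0 \<and> n = 0)"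
    by auto
  \<comment> \<open>Since \<open>m + n = t + 1\<close> the origin is avoided. In the recursion -P is
    replaced by the square of D minus that of \<Delta>, which regroups the right side into the
    odd-site value at \<open>i\<close> and the even-site value at \<open>i - 1\<close>.\<close>
  then have "half_path_sum \<Delta> P m n - \<Delta> * half_path_sum \<Delta> P m (n - 1)
      = D\<^sup>2 * half_path_sum \<Delta> P (m - 1) (n - 1)
        + \<Delta> * (half_path_sum \<Delta> P (m - 1) n - \<Delta> * half_path_sum \<Delta> P (m - 1) (n - 1))"
    unfolding assms by (subst half_path_sum_rec) (simp_all add: algebra_simps power2_eq_square)
  moreover have "correlation \<Delta> D P i (Suc t)
      = (- 1) ^ Suc t * (half_path_sum \<Delta> P m n - \<Delta> * half_path_sum \<Delta> P m (n - 1))"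
    using False by (simp add: correlation_def *)
  moreover have "correlation \<Delta> D P i t = (- 1) ^ Suc t * D * half_path_sum \<Delta> P (m - 1) (n - 1)"
    using False by (simp add: correlation_def *)
  moreover have "correlation \<Delta> D P (i - 1) t
      = (- 1) ^ t * (half_path_sum \<Delta> P (m - 1) n - \<Delta> * half_path_sum \<Delta> P (m - 1) (n - 1))"
    using False by (simp add: correlation_def *)
  ultimately show ?thesis
    using False by (simp add: power2_eq_square) (simp add: algebra_simps)
qed

subsection \<open>The correlation function\<close>

lemma integral_lines_law_spin_mean:
  assumes "p \<in> {0..1}" and "r \<in> {0..1}"
  shows "(\<integral>\<omega>. spin (\<omega> t j) \<partial>lines_law (PM (1/2)) p r) = 0"
proof (induction t arbitrary: j)
  case 0
  have "(\<lambda>x. spin (x j)) \<in> borel_measurable line_space"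
    by measurable
  then have "(\<integral>\<omega>. spin (\<omega> 0 j) \<partial>lines_law (PM (1/2)) p r) = (\<integral>x. spin (x j) \<partial>PM (1/2))"
    by (rule integral_lines_law_initial[OF prob_space_PM sets_PM, where B = 1]) simp
  then show ?case
    by (simp only: integral_PM_half_spin)
next
  case (Suc t)
  show ?case
    using integral_lines_law_spin_Suc[OF prob_space_PM sets_PM, of "\<lambda>_. 1" p r "1/2" t j] assms
    by (simp add: Suc)
qed

text \<open>Both sides start from the Kronecker delta and obey the same one-step recursion.\<close>

lemma integral_lines_law_spin_mult:
  assumes "p \<in> {0..1}" and "r \<in> {0..1}"
  shows "(\<integral>\<omega>. spin (\<omega> 0 0) * spin (\<omega> t j) \<partial>lines_law (PM (1/2)) p r)
    = correlation (1 - (p + r)) (r - p) ((2 * p - 1) * (2 * r - 1)) j t"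
proof (induction t arbitrary: j)
  case 0
  have "(\<lambda>x. spin (x 0) * spin (x j)) \<in> borel_measurable line_space"
    by measurable
  then have "(\<integral>\<omega>. spin (\<omega> 0 0) * spin (\<omega> 0 j) \<partial>lines_law (PM (1/2)) p r)
      = (\<integral>x. spin (x 0) * spin (x j) \<partial>PM (1/2))"
    by (rule integral_lines_law_initial[OF prob_space_PM sets_PM, where B = 1]) (simp add: abs_mult)
  then show ?case
    by (simp only: integral_PM_half_spin_mult correlation_0 eq_commute)
next
  case (Suc t)
  have "(r - p)\<^sup>2 = (1 - (p + r))\<^sup>2 - (2 * p - 1) * (2 * r - 1)"
    by (simp add: power2_eq_square algebra_simps)
  moreover have "(\<lambda>x. spin (x 0)) \<in> borel_measurable line_space"
    by measurable
  ultimately show ?case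
    using integral_lines_law_spin_Suc[OF prob_space_PM sets_PM, of "\<lambda>x. spin (x 0)" p r "1/2" t j] assms
    by (simp only: correlation_Suc Suc abs_spin order_refl simp_thms)
qed

lemma measurable_lines_to_field:
  "(\<lambda>\<omega> (i, t::nat). \<omega> t i) \<in> Pi\<^sub>M UNIV (\<lambda>_. line_space) \<rightarrow>\<^sub>M Pi\<^sub>M UNIV (\<lambda>_. count_space UNIV)"
proof -
  have "(\<lambda>\<omega>. \<omega> (snd z) (fst z)) \<in> Pi\<^sub>M UNIV (\<lambda>_. line_space) \<rightarrow>\<^sub>M count_space UNIV"
    for z :: "int \<times> nat"
    by (rule measurable_compose[where f = "\<lambda>\<omega>. \<omega> (snd z)" and N = line_space and g = "\<lambda>x. x (fst z)"];
        rule measurable_component_singleton; simp)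
  then have "(\<lambda>\<omega> z. \<omega> (snd z) (fst z))
      \<in> Pi\<^sub>M UNIV (\<lambda>_. line_space) \<rightarrow>\<^sub>M Pi\<^sub>M (UNIV :: (int \<times> nat) set) (\<lambda>_. count_space UNIV)"
    by (intro measurable_PiM_single') simp_all
  then show ?thesis
    by (simp add: case_prod_beta')
qed

text \<open>As \<open>of_bool k = (1 + spin k) / 2\<close> and spins are centred, every variance is
  1/4 and the covariance is a quarter of the spin correlation; the normalisation cancels this
  factor.\<close>

lemma C8_eq_correlation:
  fixes a b c d :: real
  defines "p \<equiv> a / (a + c)" and "r \<equiv> b / (b + d)"
  assumes "p \<in> {0..1}" and "r \<in> {0..1}"
  shows "C8 a b c d i t = correlation (1 - (p + r)) (r - p) ((2 * p - 1) * (2 * r - 1)) i t"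
proof -
  let ?L = "lines_law (PM (1/2)) p r"
  let ?C = "correlation (1 - (p + r)) (r - p) ((2 * p - 1) * (2 * r - 1)) i t"
  define M where "M = P8 a b c d"
  have M: "M = distr ?L (Pi\<^sub>M UNIV (\<lambda>_. count_space UNIV)) (\<lambda>\<omega> (i, t). \<omega> t i)"
    by (simp add: M_def P8_def field_law_def p_def r_def)
  have meas: "(\<lambda>\<omega> (i, t). \<omega> t i) \<in> ?L \<rightarrow>\<^sub>M Pi\<^sub>M UNIV (\<lambda>_. count_space UNIV)"
    unfolding measurable_cong_sets[OF sets_lines_law[OF prob_space_PM sets_PM] refl]
    by (rule measurable_lines_to_field)
  interpret prob_space M
    unfolding M by (rule prob_space.prob_space_distr[OF prob_space_lines_law[OF prob_space_PM sets_PM] meas])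
  have spin_meas [measurable]: "(\<lambda>\<omega>. spin (\<omega> z)) \<in> borel_measurable M" for z
    unfolding M by measurable
  have e: "(of_bool k :: real) = (1 + spin k) / 2" for k
    by (simp add: spin_def)
  have int: "integrable M (\<lambda>\<omega>. spin (\<omega> z))" for z
    by (rule integrable_const_bound[where B = 1]) auto
  have "expectation (\<lambda>\<omega>. spin (\<omega> (j, s))) = (\<integral>\<omega>. spin (\<omega> s j) \<partial>?L)" for j s
    unfolding M by (subst integral_distr[OF meas]) simp_all
  then have "expectation (\<lambda>\<omega>. spin (\<omega> z)) = 0" for z
    using integral_lines_law_spin_mean[OF assms(3,4)] by (cases z) simp
  then have mean: "expectation (\<lambda>\<omega>. of_bool (\<omega> z)) = (1 / 2 :: real)" for z
    unfolding e using int by (simp add: prob_space)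
  have centred: "of_bool k - 1 / 2 = spin k / 2" for k
    by (simp add: spin_def)
  have square: "(spin k / 2)\<^sup>2 = 1 / 4" for k
    by (simp add: power2_eq_square)
  have var: "variance (\<lambda>\<omega>. of_bool (\<omega> z)) = (1 / 4 :: real)" for z
    unfolding mean centred square by (simp add: prob_space)
  have "expectation (\<lambda>\<omega>. spin (\<omega> (0, 0)) * spin (\<omega> (i, t))) = ?C"
    unfolding integral_lines_law_spin_mult[OF assms(3,4), symmetric] M
    by (subst integral_distr[OF meas]) simp_all
  then have cov: "covariance M (\<lambda>\<omega>. of_bool (\<omega> (0, 0))) (\<lambda>\<omega>. of_bool (\<omega> (i, t))) = ?C / 4"
    unfolding covariance_def mean centred by simp
  show ?thesis
    unfolding C8_def Let_def M_def[symmetric] cov var by simp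
qed

section \<open>Closed formulas with integer indices\<close>

lemma sum_int_atLeast0_atMost:
  "(\<Sum>k = 0..int K. f k) = (\<Sum>k\<le>K. f (int k))"
  using sum.atLeast_int_atMost_int_shift[of f 0 K] by (simp add: atMost_atLeast0)

text \<open>The upper bound \<open>min m n\<close> keeps all trinomial arguments nonnegative and
  makes the sum empty outside the quadrant.\<close>

lemma half_path_sum_eq_trinom:
  "half_path_sum \<Delta> P m n
     = (\<Sum>k = 0..min m n. (- 1) powi k * trinom (m + n - k) k (m - k) (n - k)
          * \<Delta> powi (m + n - 2 * k) * P powi k)"
proof (cases "m < 0 \<or> n < 0")
  case True
  then show ?thesis
    by (auto simp: half_path_sum_def)
next
  case False
  then obtain m' n' where mn: "m = int m'" "n = int n'"
    by (metis linorder_not_less nonneg_int_cases)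
  have "path_sum \<Delta> P m' n' = (\<Sum>k\<le>min m' n'. (- P) ^ k * path_weight m' n' k * \<Delta> ^ (m' + n' - 2 * k))"
    by (rule path_sum_extend) simp
  also have "\<dots> = (\<Sum>k\<le>min m' n'. (- 1) powi int k
      * trinom (int m' + int n' - int k) (int k) (int m' - int k) (int n' - int k)
      * \<Delta> powi (int m' + int n' - 2 * int k) * P powi int k)"
  proof (rule sum.cong[OF refl])
    fix k assume "k \<in> {..min m' n'}"
    then have k: "k \<le> m'" "k \<le> n'"
      by auto
    then have "int m' + int n' - int k = int (m' + n' - k)" "int m' - int k = int (m' - k)"
        "int n' - int k = int (n' - k)" "int m' + int n' - 2 * int k = int (m' + n' - 2 * k)"
      by auto
    then show "(- P) ^ k * path_weight m' n' k * \<Delta> ^ (m' + n' - 2 * k) = (- 1) powi int k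
      * trinom (int m' + int n' - int k) (int k) (int m' - int k) (int n' - int k)
      * \<Delta> powi (int m' + int n' - 2 * int k) * P powi int k"
      by (simp only: trinom_def path_weight_multinomial[OF k] power_int_of_nat nat_int)
         (simp add: power_minus[of P])
  qed
  finally show ?thesis
    by (simp add: half_path_sum_def mn sum_int_atLeast0_atMost of_nat_min[symmetric] del: of_nat_min)
qed

lemma half_path_sum_diff:
  assumes "m + n \<ge> 0"
  shows "half_path_sum \<Delta> P m n - \<Delta> * half_path_sum \<Delta> P m (n - 1)
     = (\<Sum>k = 0..min m n. (- 1) powi k * binom (m + n - 1 - k) (n - k) * binom m k
          * \<Delta> powi (m + n - 2 * k) * P powi k)"
proof (cases "m \<le> 0 \<or> n \<le> 0")
  case True
  consider "m < 0 \<or> n < 0" | "m \<ge> 0" "n = 0" | "m = 0" "n > 0"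
    using True by linarith
  then show ?thesis
  proof cases
    case 1
    then show ?thesis
      by (auto simp: half_path_sum_def)
  next
    \<comment> \<open>Only \<open>k = 0\<close> remains; for \<open>m = 0\<close> its value 1 rests
      on the convention that -1 over 0 is 1.\<close>
    case 2
    then show ?thesis
      by (cases m) (auto simp: half_path_sum_def path_sum_0_right binom_def)
  next
    \<comment> \<open>The left side cancels, and on the right \<open>n - 1\<close> over
      \<open>n\<close> is zero.\<close>
    case 3
    then obtain n' where "n = int (Suc n')"
      by (metis gr0_conv_Suc zero_less_imp_eq_int)
    with 3 show ?thesis
      by (simp add: half_path_sum_def path_sum_0_left binom_def nat_add_distrib)
  qed
next
  case False
  then obtain m' n' where mn: "m = int m'" "n = int (Suc n')" and "m' > 0"
    by (metis gr0_conv_Suc linorder_not_le zero_less_imp_eq_int)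
  have "path_sum \<Delta> P m' (Suc n') - \<Delta> * path_sum \<Delta> P m' n'
      = (\<Sum>k\<le>min m' (Suc n'). (- 1) powi int k
      * binom (int m' + int (Suc n') - 1 - int k) (int (Suc n') - int k) * binom (int m') (int k)
      * \<Delta> powi (int m' + int (Suc n') - 2 * int k) * P powi int k)"
    unfolding path_sum_diff[OF \<open>m' > 0\<close>]
  proof (rule sum.cong[OF refl])
    fix k assume "k \<in> {..min m' (Suc n')}"
    then have k: "k \<le> m'" "k \<le> Suc n'"
      by auto
    have binom: "binom (int u) (int v) = real (u choose v)" for u v
      by (simp add: binom_def)
    have "int m' + int (Suc n') - 1 - int k = int (m' + n' - k)"
        "int (Suc n') - int k = int (Suc n' - k)" "int m' + int (Suc n') - 2 * int k = int (m' + Suc n' - 2 * k)"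
      using k \<open>m' > 0\<close> by auto
    then show "(- 1) ^ k * real ((m' + n' - k choose (Suc n' - k)) * (m' choose k))
        * \<Delta> ^ (m' + Suc n' - 2 * k) * P ^ k = (- 1) powi int k
      * binom (int m' + int (Suc n') - 1 - int k) (int (Suc n') - int k) * binom (int m') (int k)
      * \<Delta> powi (int m' + int (Suc n') - 2 * int k) * P powi int k"
      by (simp only: binom power_int_of_nat of_nat_mult mult.assoc)
  qed
  moreover have "nat n = Suc n'" "nat (n - 1) = n'" "nat m = m'" "min m n = int (min m' (Suc n'))"
    using mn by auto
  ultimately show ?thesis
    by (simp add: half_path_sum_def sum_int_atLeast0_atMost del: of_nat_min of_nat_Suc) (simp add: mn)
qed

lemma sum_int_split_last:
  fixes f :: "int \<Rightarrow> real"
  shows "(\<Sum>k = 0..n. f k) = (\<Sum>k = 0..n - 1. f k) + (if n \<ge> 0 then f n else 0)"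
proof (cases "n \<ge> 0")
  case True
  then have "{0..n} = insert n {0..n - 1}"
    by auto
  with True show ?thesis
    by simp
qed simp

lemma power_int_minus_one_cong:
  "even (m - n) \<Longrightarrow> (- 1 :: real) powi m = (- 1) powi n"
  by (cases "even m") (auto simp: power_int_minus_left)

theorem theorem1p10:
  fixes a b c d p r \<Delta> D P :: real and i :: int and t :: nat
  assumes "a \<ge> 0" and "b \<ge> 0" and "c \<ge> 0" and "d \<ge> 0"
    and "\<not> (a = 0 \<and> b = 0 \<and> c = 0 \<and> d = 0)"
    and "a + c = b + d"
    and "p = a / (a + c)" and "r = b / (b + d)"
    and "\<Delta> = 1 - (p + r)" and "D = r - p" and "P = (2 * p - 1) * (2 * r - 1)"
  shows
    "(odd (i + int t) \<longrightarrow>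
        C8 a b c d i t =
          (-1) powi (int t + 1) * D *
          (\<Sum>k = 0..(int t - 1 - \<bar>i\<bar>) div 2.
             (-1) powi k
             * trinom (int t - 1 - k) k ((int t - 1 + i) div 2 - k) ((int t - 1 - i) div 2 - k)
             * \<Delta> powi (int t - 1 - 2 * k) * P powi k))
     \<and> (even t \<and> i = 0 \<longrightarrow>
        C8 a b c d 0 t =
          (\<Sum>k = 0..int t div 2.
             (-1) powi k * binom (int t - 1 - k) (int t div 2 - k) * binom (int t div 2) k
             * \<Delta> powi (int t - 2 * k) * P powi k))
     \<and> (even (i + int t) \<and> i < 0 \<longrightarrow>
        C8 a b c d i t =
          (\<Sum>k = 0..(int t + i) div 2 - 1.
             (-1) powi (int t + k)
             * binom (int t - 1 - k) ((int t - i) div 2 - k) * binom ((int t + i) div 2) k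
             * \<Delta> powi (int t - 2 * k) * P powi k)
          + (-1) powi ((int t - i) div 2)
            * binom ((int t - i) div 2 - 1) ((int t + i) div 2 - 1)
            * \<Delta> powi (- i) * P powi ((int t + i) div 2))
     \<and> (even (i + int t) \<and> i > 0 \<longrightarrow>
        C8 a b c d i t =
          (\<Sum>k = 0..(int t - i) div 2 - 1.
             (-1) powi (int t + k)
             * binom (int t - 1 - k) ((int t - i) div 2 - k) * binom ((int t + i) div 2) k
             * \<Delta> powi (int t - 2 * k) * P powi k)
          + (-1) powi ((int t + i) div 2)
            * binom ((int t + i) div 2) ((int t - i) div 2)
            * \<Delta> powi i * P powi ((int t - i) div 2))"
proof -
  have "p \<in> {0..1}" "r \<in> {0..1}"
    using assms(1-8) by (auto simp: divide_le_eq_1)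
  then have C8: "C8 a b c d j t = correlation \<Delta> D P j t" for j
    unfolding assms(7-11) by (rule C8_eq_correlation)
  define m n where "m = (int t + i) div 2" and "n = (int t - i) div 2"
  define s where "s k = binom (int t - 1 - k) (n - k) * binom m k * \<Delta> powi (int t - 2 * k) * P powi k" for k
  \<comment> \<open>One formula for all even sites; the displayed cases with nonzero
    \<open>i\<close> arise by isolating its last summand, \<open>k = min m n\<close>.\<close>
  have even_case: "C8 a b c d i t = (\<Sum>k = 0..min m n. (- 1) powi (int t + k) * s k)"
    and sum: "m + n = int t" and diff: "m - n = i" if "even (i + int t)"
  proof -
    show mn: "m + n = int t" "m - n = i"
      using that unfolding m_def n_def by presburger+
    have "C8 a b c d i t = (- 1) powi int t * (half_path_sum \<Delta> P m n - \<Delta> * half_path_sum \<Delta> P m (n - 1))"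
      using that by (simp add: C8 correlation_def m_def n_def)
    also have "\<dots> = (\<Sum>k = 0..min m n. (- 1) powi (int t + k) * s k)"
      using mn by (subst half_path_sum_diff) (auto simp: sum_distrib_left s_def power_int_add mult.assoc)
    finally show "C8 a b c d i t = (\<Sum>k = 0..min m n. (- 1) powi (int t + k) * s k)" .
  qed
  show ?thesis
  proof (intro conjI impI; (elim conjE)?)
    assume odd: "odd (i + int t)"
    let ?m = "(int t - 1 + i) div 2" and ?n = "(int t - 1 - i) div 2"
    have "min ?m ?n = (int t - 1 - \<bar>i\<bar>) div 2" "?m + ?n = int t - 1"
      using odd by presburger+
    with odd show "C8 a b c d i t =
          (-1) powi (int t + 1) * D *
          (\<Sum>k = 0..(int t - 1 - \<bar>i\<bar>) div 2.
             (-1) powi k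
             * trinom (int t - 1 - k) k ((int t - 1 + i) div 2 - k) ((int t - 1 - i) div 2 - k)
             * \<Delta> powi (int t - 1 - 2 * k) * P powi k)"
      by (simp add: C8 correlation_def half_path_sum_eq_trinom power_int_add)
  next
    assume "even t" "i = 0"
    then have "C8 a b c d 0 t = (\<Sum>k = 0..int t div 2. (- 1) powi (int t + k) * s k)"
      using even_case by (simp add: m_def n_def)
    also have "\<dots> = (\<Sum>k = 0..int t div 2. (- 1) powi k * s k)"
      using \<open>even t\<close> by (simp add: power_int_add)
    finally show "C8 a b c d 0 t =
          (\<Sum>k = 0..int t div 2.
             (-1) powi k * binom (int t - 1 - k) (int t div 2 - k) * binom (int t div 2) k
             * \<Delta> powi (int t - 2 * k) * P powi k)"
      using \<open>i = 0\<close> by (simp add: s_def m_def n_def mult.assoc)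
  next
    assume even: "even (i + int t)" and "i < 0"
    then have "m < n" and sign: "even (int t + m - n)" and "min m n = m"
      using sum diff by presburger+
    \<comment> \<open>The last summand is \<open>k = m\<close>. Its sign is that of \<open>n\<close>
      because \<open>t + m - n = 2 * m\<close>, and symmetry replaces the lower index
      \<open>n - m\<close> by \<open>m - 1\<close>.\<close>
    have "(if m \<ge> 0 then (- 1) powi (int t + m) * s m else 0)
        = (- 1) powi n * binom (n - 1) (m - 1) * \<Delta> powi (- i) * P powi m"
    proof (cases "m \<ge> 1")
      case True
      then obtain m' n' where "m = int (Suc m')" "n = int (Suc n')" "m' < n'"
        using \<open>m < n\<close> by (metis One_nat_def Suc_le_eq int_one_le_iff_zero_less gr0_conv_Suc
            not_less_eq of_nat_less_iff order_less_trans zero_less_imp_eq_int)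
      moreover from this have "n' choose (n' - m') = n' choose m'"
        using binomial_symmetric[of m' n'] by simp
      ultimately have "binom (n - 1) (n - m) = binom (n - 1) (m - 1)" "binom m m = 1"
        by (auto simp: binom_def nat_diff_distrib)
      moreover have index: "int t - 1 - m = n - 1" "int t - 2 * m = - i"
        using sum[OF even] diff[OF even] by auto
      ultimately show ?thesis
        using True unfolding s_def power_int_minus_one_cong[OF sign] index by simp
    next
      case False
      \<comment> \<open>For \<open>m = 0\<close> both sides vanish: \<open>n - 1\<close> over
        \<open>n\<close> on the left, a negative lower index on the right. For \<open>m < 0\<close>
        there is no summand to isolate.\<close>
      then consider "m = 0" | "m < 0"
        by linarith
      then show ?thesis
        using \<open>m < n\<close> sum[OF even] by cases (auto simp: s_def binom_def)
    qed
    then show "C8 a b c d i t =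
          (\<Sum>k = 0..(int t + i) div 2 - 1.
             (-1) powi (int t + k)
             * binom (int t - 1 - k) ((int t - i) div 2 - k) * binom ((int t + i) div 2) k
             * \<Delta> powi (int t - 2 * k) * P powi k)
          + (-1) powi ((int t - i) div 2)
            * binom ((int t - i) div 2 - 1) ((int t + i) div 2 - 1)
            * \<Delta> powi (- i) * P powi ((int t + i) div 2)"
      unfolding even_case[OF even] \<open>min m n = m\<close> sum_int_split_last[of _ m]
      by (simp only: s_def flip: m_def n_def) (simp only: mult.assoc)
  next
    assume even: "even (i + int t)" and "i > 0"
    then have "n < m" and sign: "even (int t + n - m)" and "min m n = n"
      using sum diff by presburger+
    \<comment> \<open>The last summand is \<open>k = n\<close>, where the first binomial has lower
      index 0 and equals 1. For \<open>n < 0\<close> the factor \<open>binom m n\<close> makes the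
      right side zero.\<close>
    have "(if n \<ge> 0 then (- 1) powi (int t + n) * s n else 0)
        = (- 1) powi m * binom m n * \<Delta> powi i * P powi n"
    proof (cases "n \<ge> 0")
      case True
      have "int t - 2 * n = i"
        using sum[OF even] diff[OF even] by simp
      with True show ?thesis
        unfolding s_def power_int_minus_one_cong[OF sign] by (simp add: binom_def)
    next
      case False
      then show ?thesis
        by (simp add: binom_def)
    qed
    then show "C8 a b c d i t =
          (\<Sum>k = 0..(int t - i) div 2 - 1.
             (-1) powi (int t + k)
             * binom (int t - 1 - k) ((int t - i) div 2 - k) * binom ((int t + i) div 2) k
             * \<Delta> powi (int t - 2 * k) * P powi k)
          + (-1) powi ((int t + i) div 2)
            * binom ((int t + i) div 2) ((int t - i) div 2)
            * \<Delta> powi i * P powi ((int t - i) div 2)"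
      unfolding even_case[OF even] \<open>min m n = n\<close> sum_int_split_last[of _ n]
      by (simp only: s_def flip: m_def n_def) (simp only: mult.assoc)
  qed
qed

end
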